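(* Let $\mathcal W$ be a $W^*$-algebra with unit $e$ and predual $\mathcal W_*$, and let $t\in\mathcal W$. Then the following are equivalent: (A) the spectral radius of $t$ is at most $1$, $t^*t\ge e$, and $p_\infty\big((t^*t)^{-1}-t'p_\infty t'^*\big)p_\infty\ge0$; (B) the spectral radius of $t$ is at most $1$, $t^*t\ge e$, and $a\le b$. Here $p_\infty,a,b$ are as defined in the context (they are defined whenever $t^*t\ge e$).
   Context: A $W^*$-algebra is a $C^*$-algebra that is the dual of a Banach space $\mathcal W_*$ (its predual); $\sigma(\mathcal W,\mathcal W_* )$ is the corresponding weak* topology. If $t^*t\ge e$ then $t^*t$ is invertible; set $t'=t(t^*t)^{-1}$, $c_k=t'^{*k}t'^k$ (invertible) for $k\in\mathbb Z_+$, and $p_k=t'^kc_k^{-1}t'^{*k}$, $u_k=t'^{k+1}c_k^{-1}t'^{*(k+1)}$, $v_k=t'^kc_k^{-1}c_{k+1}c_k^{-1}t'^{*k}$. Then $\{p_k\}$, $\{u_k\}$, $\{v_k\}$ converge in $\sigma(\mathcal W,\mathcal W_* )$; $p_\infty$, $a$, $b$ denote their respective limits ($p_\infty$ is a projection, $a,b\ge0$). *)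

theory Defs
  imports "HOL-Analysis.Analysis"
begin

text \<open>A unital complex Banach *-algebra is modelled on a type of class
  real_normed_algebra_1 and banach (unit 1 = e), together with a complex scalar
  multiplication cs extending scaleR and an involution st.\<close>

definition cstar_algebra :: "('a::{real_normed_algebra_1,banach} \<Rightarrow> 'a) \<Rightarrow> (complex \<Rightarrow> 'a \<Rightarrow> 'a) \<Rightarrow> bool" where
  "cstar_algebra st cs \<longleftrightarrow>
     (\<forall>r x. cs (complex_of_real r) x = r *\<^sub>R x) \<and>
     (\<forall>a b x. cs (a * b) x = cs a (cs b x)) \<and>
     (\<forall>a b x. cs (a + b) x = cs a x + cs b x) \<and>
     (\<forall>a x y. cs a (x + y) = cs a x + cs a y) \<and>
     (\<forall>a x. norm (cs a x) = cmod a * norm x) \<and>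
     (\<forall>a x y. cs a (x * y) = cs a x * y \<and> cs a (x * y) = x * cs a y) \<and>
     (\<forall>x. st (st x) = x) \<and>
     (\<forall>x y. st (x + y) = st x + st y) \<and>
     (\<forall>a x. st (cs a x) = cs (cnj a) (st x)) \<and>
     (\<forall>x y. st (x * y) = st y * st x) \<and>
     (\<forall>x. norm (st x * x) = (norm x)\<^sup>2)"

definition ainvertible :: "'a::ring_1 \<Rightarrow> bool" where
  "ainvertible x \<longleftrightarrow> (\<exists>y. x * y = 1 \<and> y * x = 1)"

definition ainv :: "'a::ring_1 \<Rightarrow> 'a" where
  "ainv x = (THE y. x * y = 1 \<and> y * x = 1)"

definition aspectrum :: "(complex \<Rightarrow> 'a::ring_1 \<Rightarrow> 'a) \<Rightarrow> 'a \<Rightarrow> complex set" where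
  "aspectrum cs x = {z. \<not> ainvertible (x - cs z 1)}"

definition spectral_radius :: "(complex \<Rightarrow> 'a::ring_1 \<Rightarrow> 'a) \<Rightarrow> 'a \<Rightarrow> real" where
  "spectral_radius cs x = Sup (cmod ` aspectrum cs x)"

definition apos :: "('a::ring_1 \<Rightarrow> 'a) \<Rightarrow> (complex \<Rightarrow> 'a \<Rightarrow> 'a) \<Rightarrow> 'a \<Rightarrow> bool" where
  "apos st cs x \<longleftrightarrow> st x = x \<and> aspectrum cs x \<subseteq> {z. \<exists>r\<ge>0. z = complex_of_real r}"

definition ale :: "('a::ring_1 \<Rightarrow> 'a) \<Rightarrow> (complex \<Rightarrow> 'a \<Rightarrow> 'a) \<Rightarrow> 'a \<Rightarrow> 'a \<Rightarrow> bool" where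
  "ale st cs x y \<longleftrightarrow> apos st cs (y - x)"

definition bdd_clinear_fun :: "(complex \<Rightarrow> 'a::real_normed_vector \<Rightarrow> 'a) \<Rightarrow> ('a \<Rightarrow> complex) \<Rightarrow> bool" where
  "bdd_clinear_fun cs \<phi> \<longleftrightarrow> (\<forall>x y. \<phi> (x + y) = \<phi> x + \<phi> y) \<and> (\<forall>a x. \<phi> (cs a x) = a * \<phi> x)
     \<and> (\<exists>K. \<forall>x. cmod (\<phi> x) \<le> K * norm x)"

definition dnorm :: "('a::real_normed_vector \<Rightarrow> complex) \<Rightarrow> real" where
  "dnorm \<phi> = Sup {cmod (\<phi> x) | x. norm x \<le> 1}"

text \<open>P is a predual of the algebra: a norm-closed complex subspace of the
  dual space such that evaluation x \<mapsto> (\<phi> \<mapsto> \<phi> x) is an isometric isomorphism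
  of the algebra onto the dual of P.\<close>
definition is_predual :: "(complex \<Rightarrow> 'a::real_normed_vector \<Rightarrow> 'a) \<Rightarrow> ('a \<Rightarrow> complex) set \<Rightarrow> bool" where
  "is_predual cs P \<longleftrightarrow>
     (\<forall>\<phi>\<in>P. bdd_clinear_fun cs \<phi>) \<and>
     (\<lambda>x. 0) \<in> P \<and>
     (\<forall>\<phi>\<in>P. \<forall>\<psi>\<in>P. (\<lambda>x. \<phi> x + \<psi> x) \<in> P) \<and>
     (\<forall>a. \<forall>\<phi>\<in>P. (\<lambda>x. a * \<phi> x) \<in> P) \<and>
     (\<forall>\<phi> \<phi>s. bdd_clinear_fun cs \<phi> \<and> (\<forall>n. \<phi>s n \<in> P) \<and> (\<lambda>n. dnorm (\<lambda>x. \<phi>s n x - \<phi> x)) \<longlonglongrightarrow> 0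
         \<longrightarrow> \<phi> \<in> P) \<and>
     (\<forall>x. norm x = Sup {cmod (\<phi> x) | \<phi>. \<phi> \<in> P \<and> dnorm \<phi> \<le> 1}) \<and>
     (\<forall>F :: ('a \<Rightarrow> complex) \<Rightarrow> complex.
         (\<forall>\<phi>\<in>P. \<forall>\<psi>\<in>P. F (\<lambda>x. \<phi> x + \<psi> x) = F \<phi> + F \<psi>) \<and>
         (\<forall>a. \<forall>\<phi>\<in>P. F (\<lambda>x. a * \<phi> x) = a * F \<phi>) \<and>
         (\<exists>K. \<forall>\<phi>\<in>P. cmod (F \<phi>) \<le> K * dnorm \<phi>)
       \<longrightarrow> (\<exists>x. \<forall>\<phi>\<in>P. F \<phi> = \<phi> x))"

definition wstar_algebra :: "('a::{real_normed_algebra_1,banach} \<Rightarrow> 'a) \<Rightarrow> (complex \<Rightarrow> 'a \<Rightarrow> 'a) \<Rightarrow> ('a \<Rightarrow> complex) set \<Rightarrow> bool" where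
  "wstar_algebra st cs P \<longleftrightarrow> cstar_algebra st cs \<and> is_predual cs P"

definition wstar_tendsto :: "('a \<Rightarrow> complex) set \<Rightarrow> (nat \<Rightarrow> 'a) \<Rightarrow> 'a \<Rightarrow> bool" where
  "wstar_tendsto P f L \<longleftrightarrow> (\<forall>\<phi>\<in>P. (\<lambda>k. \<phi> (f k)) \<longlonglongrightarrow> \<phi> L)"

definition wstar_lim :: "('a \<Rightarrow> complex) set \<Rightarrow> (nat \<Rightarrow> 'a) \<Rightarrow> 'a" where
  "wstar_lim P f = (THE L. wstar_tendsto P f L)"

definition tprime :: "('a::ring_1 \<Rightarrow> 'a) \<Rightarrow> 'a \<Rightarrow> 'a" where
  "tprime st t = t * ainv (st t * t)"

definition cseq :: "('a::ring_1 \<Rightarrow> 'a) \<Rightarrow> 'a \<Rightarrow> nat \<Rightarrow> 'a" where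
  "cseq st t k = st (tprime st t) ^ k * tprime st t ^ k"

definition pseq :: "('a::ring_1 \<Rightarrow> 'a) \<Rightarrow> 'a \<Rightarrow> nat \<Rightarrow> 'a" where
  "pseq st t k = tprime st t ^ k * ainv (cseq st t k) * st (tprime st t) ^ k"

definition useq :: "('a::ring_1 \<Rightarrow> 'a) \<Rightarrow> 'a \<Rightarrow> nat \<Rightarrow> 'a" where
  "useq st t k = tprime st t ^ (k + 1) * ainv (cseq st t k) * st (tprime st t) ^ (k + 1)"

definition vseq :: "('a::ring_1 \<Rightarrow> 'a) \<Rightarrow> 'a \<Rightarrow> nat \<Rightarrow> 'a" where
  "vseq st t k = tprime st t ^ k * ainv (cseq st t k) * cseq st t (k + 1) * ainv (cseq st t k)
                 * st (tprime st t) ^ k"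

end

theory Submission
  imports Defs
begin

text \<open>Write \<open>s = t'\<close>. Since \<open>st t * s = 1\<close>, the \<open>p\<^sub>k\<close> are the range projections of \<open>s\<^sup>k\<close>; they
  decrease, and \<open>u\<^sub>k = s p\<^sub>k s\<^sup>*\<close>, \<open>v\<^sub>k = p\<^sub>k s\<^sup>* s p\<^sub>k\<close>. Hence \<open>a = s p\<^sub>\<infinity> s\<^sup>*\<close> and
  \<open>b = p\<^sub>\<infinity> (t\<^sup>* t)\<^sup>-\<^sup>1 p\<^sub>\<infinity>\<close>, and \<open>p\<^sub>\<infinity> s p\<^sub>\<infinity> = s p\<^sub>\<infinity>\<close> identifies the element in (A) with
  \<open>b - a\<close>. What has to be proved is that multiplication passes to these weak* limits. For a decreasing
  sequence of projections this follows, without any use of positivity, from the C*-identity and the weak*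
  lower semicontinuity of the norm: a limit with a component in the wrong corner would violate
  \<open>\<parallel>x + n y\<parallel>\<^sup>2 \<le> \<parallel>x\<parallel>\<^sup>2 + n\<^sup>2 \<parallel>y\<parallel>\<^sup>2\<close> for large \<open>n\<close>.\<close>

section \<open>Inverses in unital Banach algebras\<close>

lemma ainv_eq:
  fixes x :: "'a::ring_1"
  assumes "x * y = 1" "y * x = 1"
  shows "ainv x = y"
  unfolding ainv_def
proof (rule the_equality)
  show "z = y" if "x * z = 1 \<and> z * x = 1" for z
    using assms that by (metis mult.assoc mult.left_neutral mult.right_neutral)
qed (use assms in auto)

lemma ainvertible_inverse:
  fixes x :: "'a::ring_1"
  assumes "ainvertible x"
  shows "x * ainv x = 1" "ainv x * x = 1"
  using assms ainv_eq unfolding ainvertible_def by metis+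

lemma ainvertible_mult:
  fixes x y :: "'a::ring_1"
  assumes "ainvertible x" "ainvertible y"
  shows "ainvertible (x * y)"
proof -
  obtain a b where "x * a = 1" "a * x = 1" "y * b = 1" "b * y = 1"
    using assms by (auto simp: ainvertible_def)
  then have "(x * y) * (b * a) = 1" "(b * a) * (x * y) = 1"
    by (metis mult.assoc mult.right_neutral)+
  then show ?thesis unfolding ainvertible_def by blast
qed

lemma ainvertible_one_minus:
  fixes x :: "'a::{real_normed_algebra_1,banach}"
  assumes "norm x < 1"
  shows "ainvertible (1 - x)"
proof -
  have sm: "summable (\<lambda>n. x ^ n)"
    by (rule summable_comparison_test'[where g="\<lambda>n. norm x ^ n" and N=0])
       (use assms in \<open>auto simp: norm_power_ineq summable_geometric\<close>)
  define s where "s = (\<Sum>n. x ^ n)"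
  have 0: "s = 1 + (\<Sum>n. x ^ Suc n)"
    using suminf_split_head[OF sm] unfolding s_def by simp
  have "(\<Sum>n. x ^ Suc n) = x * s"
    unfolding s_def by (simp add: suminf_mult[OF sm])
  moreover have "(\<Sum>n. x ^ Suc n) = s * x"
    unfolding s_def by (simp add: suminf_mult2[OF sm] power_commutes)
  ultimately have "(1 - x) * s = 1" "s * (1 - x) = 1"
    using 0 by (auto simp: algebra_simps)
  then show ?thesis unfolding ainvertible_def by blast
qed

lemma ainvertible_scaleR:
  fixes x :: "'a::real_algebra_1"
  assumes "r \<noteq> 0" "ainvertible x"
  shows "ainvertible (r *\<^sub>R x)"
proof -
  obtain y where "x * y = 1" "y * x = 1" using assms by (auto simp: ainvertible_def)
  then have "(r *\<^sub>R x) * (inverse r *\<^sub>R y) = 1" "(inverse r *\<^sub>R y) * (r *\<^sub>R x) = 1"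
    using assms by simp_all
  then show ?thesis unfolding ainvertible_def by blast
qed

lemma norm_le_1_of_reflection:
  fixes g :: "'a::real_normed_algebra_1"
  assumes "norm (2 *\<^sub>R g - 1) \<le> 1"
  shows "norm g \<le> 1" "norm (1 - g) \<le> 1"
proof -
  have "2 *\<^sub>R g = (2 *\<^sub>R g - 1) + 1" "2 *\<^sub>R (1 - g) = 1 - (2 *\<^sub>R g - 1)"
    by (simp_all add: scaleR_2)
  moreover have "norm ((2 *\<^sub>R g - 1) + 1) \<le> 2" "norm (1 - (2 *\<^sub>R g - 1)) \<le> 2"
    using norm_triangle_ineq[of "2 *\<^sub>R g - 1" 1] norm_triangle_ineq4[of 1 "2 *\<^sub>R g - 1"] assms
    by (simp_all only: norm_one)
  ultimately have "norm (2 *\<^sub>R g) \<le> 2" "norm (2 *\<^sub>R (1 - g)) \<le> 2"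
    by (simp_all only:)
  then show "norm g \<le> 1" "norm (1 - g) \<le> 1" by simp_all
qed

text \<open>Common end of two arguments below: \<open>((n + 1) x)^2 \<le> C + (n x)^2\<close> for
  all \<open>n\<close> rearranges to this hypothesis, whose left side is unbounded unless
  \<open>x = 0\<close>.\<close>

lemma square_eq_0_of_linear_bound:
  fixes x C :: real
  assumes "\<And>n. (2 * real n + 1) * x\<^sup>2 \<le> C"
  shows "x\<^sup>2 = 0"
proof (rule ccontr)
  assume "x\<^sup>2 \<noteq> 0"
  then have pos: "x\<^sup>2 > 0" by simp
  obtain n :: nat where "real n > C / x\<^sup>2" using reals_Archimedean2 by blast
  then have "C < real n * x\<^sup>2" using pos by (simp add: field_simps)
  also have "\<dots> \<le> (2 * real n + 1) * x\<^sup>2" using pos by (intro mult_right_mono) auto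
  finally show False using assms[of n] by simp
qed

section \<open>Self-adjoint elements and unitaries of a C*-algebra\<close>

locale cstar =
  fixes st :: "'a::{real_normed_algebra_1,banach} \<Rightarrow> 'a"
    and cs :: "complex \<Rightarrow> 'a \<Rightarrow> 'a"
  assumes cstar_alg: "cstar_algebra st cs"
begin

lemma cs_of_real: "cs (complex_of_real r) x = r *\<^sub>R x"
  and cs_mult: "cs (a * b) x = cs a (cs b x)"
  and norm_cs: "norm (cs a x) = cmod a * norm x"
  and cs_mult_left: "cs a x * y = cs a (x * y)"
  and cs_mult_right: "x * cs a y = cs a (x * y)"
  and st_st [simp]: "st (st x) = x"
  and st_add: "st (x + y) = st x + st y"
  and st_cs: "st (cs a x) = cs (cnj a) (st x)"
  and st_mult: "st (x * y) = st y * st x"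
  and norm_st_mult: "norm (st x * x) = (norm x)\<^sup>2"
  using cstar_alg unfolding cstar_algebra_def by metis+

lemma st_scaleR: "st (r *\<^sub>R x) = r *\<^sub>R st x"
  using st_cs[of "complex_of_real r" x] by (simp add: cs_of_real)

lemma st_0 [simp]: "st 0 = 0"
  using st_scaleR[of 0 0] by simp

lemma st_minus: "st (- x) = - st x"
  using st_scaleR[of "-1" x] by simp

lemma st_diff: "st (x - y) = st x - st y"
  using st_add[of x "- y"] by (simp add: st_minus)

lemma st_1 [simp]: "st 1 = 1"
  by (metis mult.left_neutral mult.right_neutral st_mult st_st)

lemma st_power: "st (x ^ n) = st x ^ n"
  by (induction n) (simp_all add: st_mult power_commutes)

lemma norm_st [simp]: "norm (st x) = norm x"
proof -
  have "norm x \<le> norm (st x)" for x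
  proof (cases "x = 0")
    case False
    have "norm x * norm x \<le> norm (st x) * norm x"
      using norm_mult_ineq[of "st x" x] by (simp add: norm_st_mult power2_eq_square)
    then show ?thesis using False by simp
  qed simp
  from this[of x] this[of "st x"] show ?thesis by simp
qed

lemma norm_mult_st: "norm (x * st x) = (norm x)\<^sup>2"
  using norm_st_mult[of "st x"] by simp

lemma mult_st_eq_0: "x * st x = 0 \<Longrightarrow> x = 0"
  using norm_mult_st[of x] by auto

text \<open>The cross terms of \<open>(a + b) * st (a + b)\<close> vanish, and the C*-identity turns
  the rest into norms. This Pythagorean inequality takes the place of positivity arguments.\<close>

lemma norm_add_orthogonal:
  assumes "a * st b = 0"
  shows "(norm (a + b))\<^sup>2 \<le> (norm a)\<^sup>2 + (norm b)\<^sup>2"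
proof -
  have "b * st a = 0" using arg_cong[OF assms, of st] by (simp add: st_mult)
  then have "(a + b) * st (a + b) = a * st a + b * st b"
    using assms by (simp add: st_add algebra_simps)
  then have "(norm (a + b))\<^sup>2 = norm (a * st a + b * st b)"
    by (metis norm_mult_st)
  also have "\<dots> \<le> (norm a)\<^sup>2 + (norm b)\<^sup>2"
    by (metis norm_triangle_ineq norm_mult_st)
  finally show ?thesis .
qed

lemma norm_add_orthogonal':
  assumes "st a * b = 0"
  shows "(norm (a + b))\<^sup>2 \<le> (norm a)\<^sup>2 + (norm b)\<^sup>2"
  using norm_add_orthogonal[of "st a" "st b"] assms by (simp flip: st_add)

lemma norm_isometry_le_1:
  assumes "st u * u = 1"
  shows "norm u \<le> 1"
  using norm_st_mult[of u] assms by (auto simp: power2_eq_1_iff)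

lemma norm_projection_le_1:
  assumes "st e = e" "e * e = e"
  shows "norm e \<le> 1"
proof (cases "e = 0")
  case False
  then show ?thesis using norm_st_mult[of e] assms by (simp add: power2_eq_square)
qed simp

text \<open>The complex unit as a central element of the algebra, so that complex scalars can be
  handled by ring identities.\<close>

definition iu :: 'a where "iu = cs \<i> 1"

lemma iu_mult: "iu * x = cs \<i> x"
  by (simp add: iu_def cs_mult_left)

lemma mult_iu: "x * iu = iu * x"
  by (simp add: iu_def cs_mult_left cs_mult_right)

lemma mult_iu_left: "x * (iu * y) = iu * (x * y)"
  by (metis mult_iu mult.assoc)

lemma iu_iu: "iu * iu = - 1"
  using cs_mult[of \<i> \<i> 1] cs_of_real[of "-1" 1] by (simp add: iu_def cs_mult_left)

lemma iu_iu_mult: "iu * (iu * x) = - x"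
  by (metis iu_iu mult.assoc mult_minus1)

lemma norm_iu_mult [simp]: "norm (iu * x) = norm x"
  by (simp add: iu_mult norm_cs)

lemma st_iu: "st iu = - iu"
  using cs_mult[of "-1" \<i> 1] cs_of_real[of "-1" "cs \<i> 1"] by (simp add: iu_def st_cs)

lemma real_imaginary_parts:
  obtains a b where "st a = a" "st b = b" "x = a + iu * b"
proof
  show "st ((1/2) *\<^sub>R (x + st x)) = (1/2) *\<^sub>R (x + st x)"
    by (simp add: st_scaleR st_add add.commute)
  show "st ((1/2) *\<^sub>R (iu * (st x - x))) = (1/2) *\<^sub>R (iu * (st x - x))"
    by (simp add: st_scaleR st_mult st_diff st_iu mult_iu algebra_simps)
  show "x = (1/2) *\<^sub>R (x + st x) + iu * ((1/2) *\<^sub>R (iu * (st x - x)))"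
    by (simp add: iu_iu_mult algebra_simps flip: scaleR_left_distrib)
qed

section \<open>Cayley transforms and invertibility\<close>

lemma cayley_unitary:
  assumes y: "st y = y" and g: "(1 + iu * y) * g = 1" "g * (1 + iu * y) = 1"
  shows "st (2 *\<^sub>R g - 1) * (2 *\<^sub>R g - 1) = 1" "(2 *\<^sub>R g - 1) * st (2 *\<^sub>R g - 1) = 1"
proof -
  \<comment> \<open>As \<open>A + B = 2\<close> and \<open>g\<close> inverts \<open>A\<close>, the
    element \<open>2 g - 1\<close> is the Cayley transform \<open>B * g\<close>. It is unitary
    because \<open>st\<close> swaps the commuting elements \<open>A\<close> and
    \<open>B\<close>.\<close>
  define A where "A = 1 + iu * y"
  define B where "B = 1 - iu * y"
  have AB: "A * B = B * A" unfolding A_def B_def by (simp add: algebra_simps)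
  have stA: "st A = B"
    unfolding A_def B_def by (simp add: st_add st_mult st_iu y mult_iu)
  have stB: "st B = A" using stA by (metis st_st)
  have g: "A * g = 1" "g * A = 1" using g by (simp_all add: A_def)
  have h: "st g * B = 1" "B * st g = 1"
    using arg_cong[OF g(1), of st] arg_cong[OF g(2), of st] by (simp_all add: st_mult stA)
  have AB2: "A + B = 2 *\<^sub>R 1" unfolding A_def B_def by (simp add: scaleR_2)
  then have B: "B = 2 *\<^sub>R 1 - A" by (metis add_diff_cancel_left')
  have u: "2 *\<^sub>R g - 1 = B * g" "2 *\<^sub>R g - 1 = g * B"
    unfolding B using g by (simp_all add: algebra_simps)
  have su: "st (2 *\<^sub>R g - 1) = st g * A" "st (2 *\<^sub>R g - 1) = A * st g"
    by (simp add: u(1) st_mult stB, simp add: u(2) st_mult stB)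
  have "st g * A * (B * g) = (st g * B) * (A * g)"
    by (metis AB mult.assoc)
  then show "st (2 *\<^sub>R g - 1) * (2 *\<^sub>R g - 1) = 1"
    using g h u(1) su(1) by simp
  have "g * B * (A * st g) = (g * A) * (B * st g)"
    by (metis AB mult.assoc)
  then show "(2 *\<^sub>R g - 1) * st (2 *\<^sub>R g - 1) = 1"
    using g h u(2) su(2) by simp
qed

text \<open>Far from the real axis the resolvent of a self-adjoint element is a Neumann series; its
  Cayley transform being unitary bounds the resolvent well enough that one more Neumann step
  covers the whole half plane.\<close>

lemma ainvertible_one_plus_iu:
  assumes y: "st y = y"
  shows "ainvertible (1 + iu * y)"
proof -
  \<comment> \<open>Larger than the norm of \<open>y\<close>, so that a Neumann series inverts
    \<open>1 + i y / n\<close>; \<open>n \<ge> 1\<close> keeps \<open>(n - 1) / n\<close> in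
    \<open>[0, 1)\<close>.\<close>
  define n where "n = norm y + 1"
  have n: "n \<ge> 1" "norm y < n" by (simp_all add: n_def)
  have "norm (iu * ((- 1 / n) *\<^sub>R y)) < 1" using n by (simp add: divide_simps)
  from ainvertible_one_minus[OF this]
  have inv: "ainvertible (1 + iu * ((1 / n) *\<^sub>R y))" by simp
  define g where "g = ainv (1 + iu * ((1 / n) *\<^sub>R y))"
  note g = ainvertible_inverse[OF inv, folded g_def]
  have "norm (2 *\<^sub>R g - 1) \<le> 1"
    by (rule norm_isometry_le_1, rule cayley_unitary(1)[OF _ g]) (simp add: st_scaleR y)
  then have "norm g \<le> 1" by (rule norm_le_1_of_reflection)
  then have "norm (((n - 1) / n) *\<^sub>R g) \<le> (n - 1) / n"
    using n by (simp add: divide_right_mono mult_left_le)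
  also have "\<dots> < 1" using n by (simp add: field_simps)
  finally have "ainvertible (1 - ((n - 1) / n) *\<^sub>R g)" by (rule ainvertible_one_minus)
  then have "ainvertible (n *\<^sub>R (1 + iu * ((1 / n) *\<^sub>R y)) * (1 - ((n - 1) / n) *\<^sub>R g))"
    using inv n by (intro ainvertible_mult ainvertible_scaleR) auto
  \<comment> \<open>With \<open>A = 1 + i y / n\<close> inverted by \<open>g\<close>, the product is
    \<open>n A - (n - 1) A g = n A - (n - 1) = 1 + i y\<close>.\<close>
  also have "n *\<^sub>R (1 + iu * ((1 / n) *\<^sub>R y)) * (1 - ((n - 1) / n) *\<^sub>R g)
      = n *\<^sub>R (1 + iu * ((1 / n) *\<^sub>R y)) - (n - 1) *\<^sub>R ((1 + iu * ((1 / n) *\<^sub>R y)) * g)"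
    using n by (simp only: right_diff_distrib mult_scaleR_left mult_scaleR_right scaleR_scaleR mult_1_right) simp
  also have "\<dots> = 1 + iu * y"
    unfolding g using n by (simp add: algebra_simps)
  finally show ?thesis .
qed

lemma cayley:
  assumes y: "st y = y"
  obtains g u where "(1 + iu * y) * g = 1" "g * (1 + iu * y) = 1" "u = 2 *\<^sub>R g - 1"
    "st u * u = 1" "u * st u = 1" "norm g \<le> 1" "norm (1 - g) \<le> 1"
proof -
  define g where "g = ainv (1 + iu * y)"
  note g = ainvertible_inverse[OF ainvertible_one_plus_iu[OF y], folded g_def]
  note u = cayley_unitary[OF y g]
  show thesis
    by (rule that[OF g refl u]) (use norm_le_1_of_reflection[OF norm_isometry_le_1[OF u(1)]] in auto)
qed

text \<open>A left inverse bounds \<open>x\<close> from below, hence also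
  \<open>h = st x * x\<close>. Since \<open>h\<close> is self-adjoint, \<open>h + \<beta> i\<close>
  is invertible, and the lower bound makes its inverse \<open>G\<close> so small that subtracting
  \<open>\<beta> i\<close> is a Neumann perturbation.\<close>

lemma ainvertible_st_mult:
  assumes L: "L * x = 1"
  shows "ainvertible (st x * x)"
proof -
  define h where "h = st x * x"
  define \<delta> where "\<delta> = 1 / (norm L)\<^sup>2"
  have "L \<noteq> 0" using L by auto
  then have \<delta>: "\<delta> > 0" by (simp add: \<delta>_def)
  have h: "st h = h" by (simp add: h_def st_mult)
  have below: "\<delta> * norm y \<le> norm (h * y)" for y
  proof (cases "y = 0")
    case False
    have "norm y = norm (L * (x * y))" by (metis L mult.assoc mult_1)
    also have "\<dots> \<le> norm L * norm (x * y)" by (rule norm_mult_ineq)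
    finally have "(norm y)\<^sup>2 \<le> (norm L)\<^sup>2 * (norm (x * y))\<^sup>2"
      by (metis norm_ge_zero power_mono power_mult_distrib)
    also have "(norm (x * y))\<^sup>2 = norm (st y * (h * y))"
      using norm_st_mult[of "x * y"] by (simp add: h_def st_mult mult.assoc)
    also have "\<dots> \<le> norm y * norm (h * y)"
      by (metis norm_mult_ineq norm_st)
    finally have "(norm y)\<^sup>2 \<le> (norm L)\<^sup>2 * (norm y * norm (h * y))"
      using \<open>L \<noteq> 0\<close> by simp
    then have "norm y \<le> (norm L)\<^sup>2 * norm (h * y)"
      using False by (simp add: power2_eq_square)
    then show ?thesis using \<open>L \<noteq> 0\<close> by (simp add: \<delta>_def field_simps)
  qed simp
  \<comment> \<open>A quarter of the lower bound: then
    \<open>4 \<beta> |G| \<le> |h G| \<le> 1 + \<beta> |G|\<close>, so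
    \<open>\<beta> |G| \<le> 1/3\<close>.\<close>
  define \<beta> where "\<beta> = \<delta> / 4"
  have \<beta>: "\<beta> > 0" using \<delta> by (simp add: \<beta>_def)
  have "ainvertible (1 + iu * ((- 1 / \<beta>) *\<^sub>R h))"
    by (rule ainvertible_one_plus_iu) (simp add: st_scaleR st_minus h)
  moreover have "ainvertible iu"
    unfolding ainvertible_def by (rule exI[of _ "- iu"]) (simp add: iu_iu)
  ultimately have "ainvertible (\<beta> *\<^sub>R (iu * (1 + iu * ((- 1 / \<beta>) *\<^sub>R h))))"
    using \<beta> by (intro ainvertible_scaleR ainvertible_mult) auto
  also have "\<beta> *\<^sub>R (iu * (1 + iu * ((- 1 / \<beta>) *\<^sub>R h))) = h + \<beta> *\<^sub>R iu"
    using \<beta> by (simp add: algebra_simps iu_iu_mult)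
  finally have inv: "ainvertible (h + \<beta> *\<^sub>R iu)" .
  define G where "G = ainv (h + \<beta> *\<^sub>R iu)"
  have G: "(h + \<beta> *\<^sub>R iu) * G = 1" unfolding G_def by (rule ainvertible_inverse(1)[OF inv])
  have "h * G = 1 - \<beta> *\<^sub>R (iu * G)" using G by (simp add: algebra_simps)
  then have "norm (h * G) \<le> 1 + \<beta> * norm G"
    using norm_triangle_ineq4[of 1 "\<beta> *\<^sub>R (iu * G)"] \<beta> by simp
  with below[of G] have "4 * \<beta> * norm G \<le> 1 + \<beta> * norm G" by (simp add: \<beta>_def)
  then have "norm (\<beta> *\<^sub>R (iu * G)) < 1" using \<beta> by simp
  from ainvertible_mult[OF inv ainvertible_one_minus[OF this]]
  have "ainvertible ((h + \<beta> *\<^sub>R iu) - \<beta> *\<^sub>R (iu * ((h + \<beta> *\<^sub>R iu) * G)))"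
    by (simp add: right_diff_distrib mult_iu_left)
  then show ?thesis unfolding G by (simp add: h_def)
qed

text \<open>Resolvents of \<open>y\<^sup>2\<close> provide an approximate unit for \<open>y\<close> inside the algebra it generates.\<close>

lemma self_adjoint_approximate_unit:
  assumes y: "st y = y" and n: "n > 0"
  obtains f b where "st f = f" "norm f \<le> 1" "norm (f * y - y) \<le> 1 / n" "f = b * y"
proof -
  have ny: "st (n *\<^sub>R y) = n *\<^sub>R y" by (simp add: st_scaleR y)
  obtain g u where g: "(1 + iu * n *\<^sub>R y) * g = 1" "g * (1 + iu * n *\<^sub>R y) = 1"
    and u: "u = 2 *\<^sub>R g - 1" "st u * u = 1" "u * st u = 1" and ng: "norm g \<le> 1" "norm (1 - g) \<le> 1"
    using cayley[OF ny] by blast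
  \<comment> \<open>Since \<open>g * st g\<close> inverts \<open>1 + n^2 y^2\<close>, this is
    \<open>n^2 y^2 / (1 + n^2 y^2)\<close>. In terms of the unitary \<open>u\<close>,
    \<open>4 f = (1 - u) + (1 - st u)\<close>, which gives the norm bound.\<close>
  define f where "f = 1 - g * st g"
  have sg: "st g * (1 - iu * n *\<^sub>R y) = 1"
    using arg_cong[OF g(1), of st] by (simp add: st_mult st_add st_iu ny y st_scaleR mult_iu)
  have "(2 *\<^sub>R g) * st (2 *\<^sub>R g) = (1 + u) * (1 + st u)"
    by (simp add: u st_diff)
  also have "\<dots> = 1 + 1 + u + st u" using u(3) by (simp add: algebra_simps)
  finally have "4 *\<^sub>R (g * st g) = 1 + 1 + u + st u" by (simp add: st_scaleR)
  moreover have "4 *\<^sub>R (1::'a) = 1 + 1 + 1 + 1" by (simp add: scaleR_conv_of_real)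
  ultimately have f4: "4 *\<^sub>R f = (1 - u) + (1 - st u)"
    unfolding f_def scaleR_right_diff_distrib by simp
  have nu: "norm (1 - u) \<le> 2" "norm (1 - st u) \<le> 2"
    using norm_triangle_ineq4[of 1 u] norm_triangle_ineq4[of 1 "st u"] norm_isometry_le_1[OF u(2)]
    by simp_all
  have "norm (4 *\<^sub>R f) \<le> 4"
    unfolding f4 using norm_triangle_ineq[of "1 - u" "1 - st u"] nu by linarith
  then have nf: "norm f \<le> 1" by simp
  have sf: "st f = f" by (simp add: f_def st_diff st_mult)
  have "1 = g * (st g * (1 - iu * n *\<^sub>R y)) * (1 + iu * n *\<^sub>R y)" using sg g by simp
  also have "\<dots> = g * st g * ((1 - iu * n *\<^sub>R y) * (1 + iu * n *\<^sub>R y))" by (simp add: mult.assoc)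
  also have "(1 - iu * n *\<^sub>R y) * (1 + iu * n *\<^sub>R y) = 1 + (n * n) *\<^sub>R (y * y)"
  proof -
    have "(iu * n *\<^sub>R y) * (iu * n *\<^sub>R y) = iu * (iu * (n *\<^sub>R y * n *\<^sub>R y))"
      by (metis mult.assoc mult_iu)
    then have "(iu * n *\<^sub>R y) * (iu * n *\<^sub>R y) = - ((n * n) *\<^sub>R (y * y))"
      by (simp add: iu_iu_mult)
    then show ?thesis by (simp only: left_diff_distrib distrib_left mult_1_left mult_1_right) simp
  qed
  finally have "f = (n * n) *\<^sub>R (g * st g * y) * y"
    unfolding f_def by (simp add: algebra_simps)
  moreover have "norm (f * y - y) \<le> 1 / n"
  proof -
    \<comment> \<open>The right side has norm at most 1, so \<open>y * g\<close> is of size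
      \<open>1 / n\<close>; up to sign and adjoint the error \<open>f * y - y\<close> is
      \<open>y * g * st g\<close>.\<close>
    have "n *\<^sub>R (iu * (y * g)) = 1 - g" using g(1) by (simp add: algebra_simps)
    then have "n * norm (y * g) \<le> 1"
      using ng(2) n by (metis norm_iu_mult norm_scaleR abs_of_pos)
    then have "norm (y * g) \<le> 1 / n" using n by (simp add: field_simps)
    moreover have "norm (y * g * st g) \<le> norm (y * g) * 1"
      by (rule order_trans[OF norm_mult_ineq]) (use ng(1) in \<open>auto intro: mult_left_le\<close>)
    moreover have "norm (f * y - y) = norm (y * g * st g)"
    proof -
      have "st (f * y - y) = - (y * g * st g)"
        by (simp add: f_def st_diff st_mult st_minus y algebra_simps)
      then show ?thesis by (metis norm_minus_cancel norm_st)
    qed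
    ultimately show ?thesis by simp
  qed
  ultimately show thesis using that sf nf by blast
qed

text \<open>The supremum \<open>\<kappa>\<close> of \<open>norm (z * f)\<close> over self-adjoint contractions \<open>f\<close> of the hereditary subalgebra
  is nearly attained at some \<open>f\<close>; taking \<open>w = n z g\<close> with an approximate unit \<open>g\<close> for \<open>f\<close> gives
  \<open>((n + 1) \<kappa>)\<^sup>2 \<le> C + (n \<kappa>)\<^sup>2\<close> for all \<open>n\<close>.\<close>

lemma annihilates_hereditary:
  assumes p: "\<And>j. st (p j) = p j"
    and z: "\<And>w. (\<forall>j::nat. w * p j = w) \<Longrightarrow> (norm (z + w))\<^sup>2 \<le> C + (norm w)\<^sup>2"
    and y: "\<And>j. p j * y = y"
  shows "z * y = 0"
proof -
  define H where "H = {f. st f = f \<and> norm f \<le> 1 \<and> (\<forall>j. f * p j = f)}"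
  define \<kappa> where "\<kappa> = (SUP f\<in>H. norm (z * f))"
  have bdd: "bdd_above ((\<lambda>f. norm (z * f)) ` H)"
  proof (rule bdd_aboveI2)
    fix f assume "f \<in> H"
    then show "norm (z * f) \<le> norm z"
      by (intro order_trans[OF norm_mult_ineq mult_left_le]) (auto simp: H_def)
  qed
  have ne: "0 \<in> H" by (simp add: H_def)
  have \<kappa>: "norm (z * f) \<le> \<kappa>" if "f \<in> H" for f
    unfolding \<kappa>_def using bdd that by (rule cSUP_upper2) simp
  have \<kappa>0: "\<kappa> \<ge> 0" using \<kappa>[OF ne] by simp
  have key: "(real n + 1) * norm (z * f) \<le> sqrt (C + (real n * \<kappa>)\<^sup>2)" if f: "f \<in> H" for f n
  proof (rule field_le_epsilon)
    fix \<epsilon> :: real assume \<epsilon>: "\<epsilon> > 0"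
    define m where "m = (real n * norm z + 1) / \<epsilon>"
    have m: "m > 0" using \<epsilon> by (simp add: m_def add_nonneg_pos)
    obtain g b where g: "st g = g" "norm g \<le> 1" "norm (g * f - f) \<le> 1 / m" "g = b * f"
      using self_adjoint_approximate_unit[OF _ m, of f] f unfolding H_def by blast
    have gH: "g \<in> H" using g f by (simp add: H_def mult.assoc)
    have "(norm (z + real n *\<^sub>R (z * g)))\<^sup>2 \<le> C + (norm (real n *\<^sub>R (z * g)))\<^sup>2"
      using gH by (intro z) (simp add: H_def mult.assoc)
    also have "\<dots> \<le> C + (real n * \<kappa>)\<^sup>2"
      using \<kappa>[OF gH] by (simp add: power_mono mult_left_mono)
    finally have le: "norm (z + real n *\<^sub>R (z * g)) \<le> sqrt (C + (real n * \<kappa>)\<^sup>2)"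
      by (rule real_le_rsqrt)
    have "(real n + 1) *\<^sub>R (z * f) = (z + real n *\<^sub>R (z * g)) * f - real n *\<^sub>R (z * (g * f - f))"
      by (simp add: algebra_simps)
    then have "norm ((real n + 1) *\<^sub>R (z * f))
        \<le> norm ((z + real n *\<^sub>R (z * g)) * f) + norm (real n *\<^sub>R (z * (g * f - f)))"
      by (metis norm_triangle_ineq4)
    moreover have "norm ((z + real n *\<^sub>R (z * g)) * f) \<le> norm (z + real n *\<^sub>R (z * g))"
      by (rule order_trans[OF norm_mult_ineq mult_left_le]) (use f in \<open>auto simp: H_def\<close>)
    moreover have "norm (real n *\<^sub>R (z * (g * f - f))) \<le> \<epsilon>"
    proof -
      have "norm (z * (g * f - f)) \<le> norm z * (1 / m)"
        by (rule order_trans[OF norm_mult_ineq]) (rule mult_left_mono[OF g(3) norm_ge_zero])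
      then have "norm (real n *\<^sub>R (z * (g * f - f))) \<le> real n * (norm z * (1 / m))"
        using mult_left_mono[of _ _ "real n"] by fastforce
      also have "\<dots> \<le> (real n * norm z + 1) / m" using m by (simp add: field_simps)
      also have "\<dots> = \<epsilon>" unfolding m_def using \<epsilon>
        by (simp add: add_nonneg_pos less_imp_neq[symmetric])
      finally show ?thesis .
    qed
    ultimately show "(real n + 1) * norm (z * f) \<le> sqrt (C + (real n * \<kappa>)\<^sup>2) + \<epsilon>"
      using le by simp
  qed
  have C: "C \<ge> 0" using z[of 0] by (simp add: order_trans[OF zero_le_power2])
  have "(2 * real n + 1) * \<kappa>\<^sup>2 \<le> C" for n
  proof -
    have "(SUP f\<in>H. norm (z * f)) \<le> sqrt (C + (real n * \<kappa>)\<^sup>2) / (real n + 1)"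
      by (rule cSUP_least) (use ne key in \<open>auto simp: field_simps\<close>)
    then have "\<kappa> \<le> sqrt (C + (real n * \<kappa>)\<^sup>2) / (real n + 1)" by (simp only: \<kappa>_def)
    then have "(real n + 1) * \<kappa> \<le> sqrt (C + (real n * \<kappa>)\<^sup>2)" by (simp add: field_simps)
    then have "((real n + 1) * \<kappa>)\<^sup>2 \<le> (sqrt (C + (real n * \<kappa>)\<^sup>2))\<^sup>2"
      using \<kappa>0 by (intro power_mono) auto
    also have "\<dots> = C + (real n * \<kappa>)\<^sup>2" using C by (intro real_sqrt_pow2) simp
    finally show ?thesis by (simp add: power2_eq_square algebra_simps)
  qed
  then have "\<kappa>\<^sup>2 = 0" by (rule square_eq_0_of_linear_bound)
  then have zf: "z * f = 0" if "f \<in> H" for f using \<kappa>[OF that] by simp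
  \<comment> \<open>The normalised \<open>y * st y\<close> lies in \<open>H\<close>, so
    \<open>z\<close> kills it; then \<open>(z y) * st (z y) = 0\<close> forces
    \<open>z y = 0\<close>.\<close>
  define h where "h = (1 / (norm (y * st y) + 1)) *\<^sub>R (y * st y)"
  have "st y * p j = st y" for j using y[of j] p by (metis st_mult)
  moreover have "norm (y * st y) + 1 > 0" by (simp add: add_nonneg_pos)
  ultimately have "h \<in> H"
    unfolding H_def h_def by (auto simp: st_scaleR st_mult mult.assoc divide_simps)
  then have "z * h = 0" by (rule zf)
  then have "z * (y * st y) = 0"
    unfolding h_def by (simp add: add_nonneg_eq_0_iff)
  then have "(z * y) * st (z * y) = 0"
    by (metis mult.assoc mult_zero_left st_mult)
  then show ?thesis by (rule mult_st_eq_0)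
qed

section \<open>Bounded functionals and decreasing sequences of projections\<close>

context
  fixes \<phi> assumes \<phi>: "bdd_clinear_fun cs \<phi>"
begin

lemma functional_add: "\<phi> (x + y) = \<phi> x + \<phi> y"
  and functional_cs: "\<phi> (cs a x) = a * \<phi> x"
  using \<phi> unfolding bdd_clinear_fun_def by blast+

lemma functional_scaleR: "\<phi> (r *\<^sub>R x) = complex_of_real r * \<phi> x"
  using functional_cs[of "complex_of_real r" x] by (simp add: cs_of_real)

lemma functional_0: "\<phi> 0 = 0"
  using functional_scaleR[of 0 0] by simp

lemma functional_minus: "\<phi> (- x) = - \<phi> x"
  using functional_scaleR[of "-1" x] by simp

lemma functional_diff: "\<phi> (x - y) = \<phi> x - \<phi> y"
  using functional_add[of x "- y"] by (simp add: functional_minus)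

lemma functional_iu: "\<phi> (iu * x) = \<i> * \<phi> x"
  by (simp add: iu_mult functional_cs)

lemma cmod_functional_le: "cmod (\<phi> x) \<le> dnorm \<phi> * norm x"
proof (cases "x = 0")
  case False
  obtain K where K: "\<And>x. cmod (\<phi> x) \<le> K * norm x"
    using \<phi> unfolding bdd_clinear_fun_def by blast
  have "bdd_above {cmod (\<phi> x) | x. norm x \<le> 1}"
  proof (rule bdd_aboveI, clarsimp)
    fix x :: 'a assume "norm x \<le> 1"
    then have "\<bar>K\<bar> * norm x \<le> \<bar>K\<bar>" by (simp add: mult_left_le)
    moreover have "K * norm x \<le> \<bar>K\<bar> * norm x" by (simp add: mult_right_mono)
    ultimately show "cmod (\<phi> x) \<le> \<bar>K\<bar>" using K[of x] by linarith
  qed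
  then have "cmod (\<phi> ((1 / norm x) *\<^sub>R x)) \<le> dnorm \<phi>"
    unfolding dnorm_def by (rule cSup_upper[rotated]) (use False in auto)
  then show ?thesis using False by (simp add: functional_scaleR norm_mult norm_divide field_simps)
qed (simp add: functional_0)

lemma dnorm_nonneg: "0 \<le> dnorm \<phi>"
  using cmod_functional_le[of 1] by (metis norm_ge_zero mult.right_neutral norm_one order_trans)

text \<open>Only boundedness of the translate is claimed, not membership in the predual. For this
  reason the convergence results below are stated for arbitrary bounded functionals.\<close>

lemma functional_mult_left: "bdd_clinear_fun cs (\<lambda>y. \<phi> (x * y))"
proof -
  have "cmod (\<phi> (x * y)) \<le> (dnorm \<phi> * norm x) * norm y" for y
    using cmod_functional_le[of "x * y"] mult_left_mono[OF norm_mult_ineq[of x y] dnorm_nonneg]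
    by (simp add: mult.assoc)
  then show ?thesis
    unfolding bdd_clinear_fun_def
    by (auto simp: distrib_left functional_add functional_cs cs_mult_right)
qed

end

text \<open>The order is encoded algebraically; the case \<open>j = k\<close> of the second clause
  is idempotence.\<close>

definition dec_projections :: "(nat \<Rightarrow> 'a) \<Rightarrow> bool" where
  "dec_projections p \<longleftrightarrow> (\<forall>k. st (p k) = p k) \<and> (\<forall>j k. j \<le> k \<longrightarrow> p j * p k = p k)"

lemma dec_projectionsD:
  assumes "dec_projections p"
  shows "st (p k) = p k" "p k * p k = p k" "norm (p k) \<le> 1"
    "j \<le> k \<Longrightarrow> p j * p k = p k" "j \<le> k \<Longrightarrow> p k * p j = p k"
proof -
  show 1: "st (p k) = p k" for k using assms unfolding dec_projections_def by blast
  show 2: "p k * p k = p k" and 3: "j \<le> k \<Longrightarrow> p j * p k = p k"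
    using assms unfolding dec_projections_def by blast+
  show "norm (p k) \<le> 1" using 1 2 by (rule norm_projection_le_1)
  show "j \<le> k \<Longrightarrow> p k * p j = p k" using 1 3 by (metis st_mult)
qed

lemma dec_projections_conjugate:
  assumes p: "dec_projections p" and v: "st v * v = 1" "v * st v = 1"
  shows "dec_projections (\<lambda>k. st v * p k * v)"
proof -
  have eq: "st v * p j * v * (st v * p k * v) = st v * (p j * p k) * v" for j k
  proof -
    have "st v * p j * v * (st v * p k * v) = st v * (p j * (v * st v) * p k) * v"
      by (simp only: mult.assoc)
    then show ?thesis by (simp add: v(2))
  qed
  show ?thesis
    unfolding dec_projections_def eq using dec_projectionsD[OF p] by (simp add: st_mult mult.assoc)
qed

text \<open>A gliding hump: otherwise one finds orthogonal differences \<open>e\<^sub>1, \<dots>, e\<^sub>n\<close> of the projections and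
  contractions \<open>x\<^sub>i\<close> such that \<open>\<Sum> e\<^sub>i x\<^sub>i\<close> has norm at most \<open>\<surd>n\<close> while \<open>\<phi>\<close> takes a
  value of size \<open>n \<epsilon>\<close> on it.\<close>

lemma dec_projections_uniformly_Cauchy:
  assumes p: "dec_projections p" and \<phi>: "bdd_clinear_fun cs \<phi>" and \<epsilon>: "\<epsilon> > 0"
  shows "\<exists>N. \<forall>k\<ge>N. \<forall>j\<ge>N. \<forall>x. norm x \<le> 1 \<longrightarrow> cmod (\<phi> (p k * x) - \<phi> (p j * x)) \<le> \<epsilon>"
proof (rule ccontr)
  note pD = dec_projectionsD[OF p]
  assume H: "\<not> ?thesis"
  have pair: "\<exists>k j x. N \<le> k \<and> k \<le> j \<and> norm x \<le> 1 \<and> cmod (\<phi> ((p k - p j) * x)) > \<epsilon>" for N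
  proof -
    obtain k j x where *: "N \<le> k" "N \<le> j" "norm x \<le> 1" "\<epsilon> < cmod (\<phi> (p k * x) - \<phi> (p j * x))"
      using H by (force simp: not_le)
    have "cmod (\<phi> ((p k - p j) * x)) > \<epsilon>" "cmod (\<phi> ((p j - p k) * x)) > \<epsilon>"
      using *(4) by (simp_all add: left_diff_distrib functional_diff[OF \<phi>] norm_minus_commute)
    then show ?thesis using * by (metis nle_le)
  qed
  \<comment> \<open>The invariant \<open>p m * z = 0\<close> makes every difference
    \<open>p k - p j\<close> with \<open>m \<le> k \<le> j\<close> annihilate \<open>z\<close>. The
    next summand is therefore orthogonal to \<open>z\<close>, and the squared norm grows by at most
    1 per step.\<close>
  have hump: "\<exists>m z. p m * z = 0 \<and> (norm z)\<^sup>2 \<le> real n \<and> real n * \<epsilon> \<le> Re (\<phi> z)" for n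
  proof (induction n)
    case 0
    show ?case by (rule exI[of _ 0], rule exI[of _ 0]) (simp add: functional_0[OF \<phi>])
  next
    case (Suc n)
    then obtain m z where z: "p m * z = 0" "(norm z)\<^sup>2 \<le> real n" "real n * \<epsilon> \<le> Re (\<phi> z)" by blast
    obtain k j x where x: "m \<le> k" "k \<le> j" "norm x \<le> 1" "cmod (\<phi> ((p k - p j) * x)) > \<epsilon>"
      using pair by blast
    define w where "w = \<phi> ((p k - p j) * x)"
    define \<theta> where "\<theta> = cnj w / complex_of_real (cmod w)"
    have w0: "w \<noteq> 0" using x(4) \<epsilon> unfolding w_def by auto
    define a where "a = (p k - p j) * cs \<theta> x"
    have "cmod \<theta> = 1" using w0 by (simp add: \<theta>_def norm_divide)
    then have nx: "norm (cs \<theta> x) \<le> 1" using x(3) by (simp add: norm_cs)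
    have "\<phi> a = \<theta> * w" unfolding a_def w_def by (simp add: cs_mult_right functional_cs[OF \<phi>])
    also have "\<dots> = complex_of_real (cmod w)"
      using w0 complex_norm_square[of w] by (simp add: \<theta>_def field_simps power2_eq_square)
    finally have Re: "Re (\<phi> a) \<ge> \<epsilon>" using x(4) by (simp add: w_def)
    have e: "st (p k - p j) = p k - p j" "(p k - p j) * (p k - p j) = p k - p j"
      using pD x(2) by (simp_all add: st_diff left_diff_distrib right_diff_distrib)
    have "norm a \<le> norm (p k - p j) * norm (cs \<theta> x)" unfolding a_def by (rule norm_mult_ineq)
    also have "\<dots> \<le> 1" using norm_projection_le_1[OF e] nx by (simp add: mult_le_one)
    finally have na: "(norm a)\<^sup>2 \<le> 1" by (simp add: abs_square_le_1)
    have "p l * z = 0" if "m \<le> l" for l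
      using pD(5)[OF that] z(1) by (metis mult.assoc mult_zero_right)
    then have "(p k - p j) * z = 0" and jz: "p j * z = 0" using x by (simp_all add: left_diff_distrib)
    then have "st z * a = 0"
      unfolding a_def using e(1) by (metis mult.assoc mult_zero_left st_0 st_mult)
    then have "(norm (z + a))\<^sup>2 \<le> real (Suc n)"
      using norm_add_orthogonal'[of z a] z(2) na by simp
    moreover have "p j * (p k - p j) = 0" using pD x(2) by (simp add: right_diff_distrib)
    then have "p j * (z + a) = 0"
      using jz by (simp add: a_def distrib_left flip: mult.assoc)
    moreover have "real (Suc n) * \<epsilon> \<le> Re (\<phi> (z + a))"
      using z(3) Re by (simp add: functional_add[OF \<phi>] algebra_simps)
    ultimately show ?case by blast
  qed
  define C where "C = dnorm \<phi>"
  obtain n :: nat where n: "real n > C\<^sup>2 / \<epsilon>\<^sup>2" using reals_Archimedean2 by blast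
  then have n0: "real n > 0" by (smt (verit) zero_le_divide_iff zero_le_power2)
  obtain z where z: "(norm z)\<^sup>2 \<le> real n" "real n * \<epsilon> \<le> Re (\<phi> z)" using hump by blast
  have "real n * \<epsilon> \<le> C * norm z"
    using z(2) cmod_functional_le[OF \<phi>, of z] complex_Re_le_cmod[of "\<phi> z"] by (simp add: C_def)
  then have "(real n * \<epsilon>)\<^sup>2 \<le> (C * norm z)\<^sup>2" using \<epsilon> by (intro power_mono) auto
  also have "\<dots> \<le> C\<^sup>2 * real n" using z(1) by (simp add: power_mult_distrib mult_left_mono)
  finally have "real n * (real n * \<epsilon>\<^sup>2) \<le> real n * C\<^sup>2"
    by (simp add: power_mult_distrib power2_eq_square mult_ac)
  then have "real n * \<epsilon>\<^sup>2 \<le> C\<^sup>2" using n0 by (rule mult_left_le_imp_le)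
  with n \<epsilon> show False by (simp add: field_simps)
qed

text \<open>The left factor is absorbed in the functional \<open>\<lambda>y. \<phi> (x * y)\<close>,
  and the uniform Cauchy estimate is used at the single element \<open>1\<close>.\<close>

lemma dec_projections_convergent:
  assumes p: "dec_projections p" and \<phi>: "bdd_clinear_fun cs \<phi>"
  shows "convergent (\<lambda>k. \<phi> (x * p k))"
proof -
  have "Cauchy (\<lambda>k. \<phi> (x * p k))"
  proof (rule metric_CauchyI)
    fix \<epsilon> :: real assume "\<epsilon> > 0"
    then have "\<epsilon> / 2 > 0" by simp
    from dec_projections_uniformly_Cauchy[OF p functional_mult_left[OF \<phi>, of x] this]
    obtain N where "\<And>k j. k \<ge> N \<Longrightarrow> j \<ge> N \<Longrightarrow> cmod (\<phi> (x * (p k * 1)) - \<phi> (x * (p j * 1))) \<le> \<epsilon> / 2"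
      by (metis norm_one order_refl)
    then show "\<exists>M. \<forall>m\<ge>M. \<forall>n\<ge>M. dist (\<phi> (x * p m)) (\<phi> (x * p n)) < \<epsilon>"
      using \<open>\<epsilon> > 0\<close> by (intro exI[of _ N]) (fastforce simp: dist_norm)
  qed
  then show ?thesis by (rule Cauchy_convergent)
qed

end

section \<open>Weak* sequential limits\<close>

locale wstar = cstar st cs
  for st :: "'a::{real_normed_algebra_1,banach} \<Rightarrow> 'a" and cs :: "complex \<Rightarrow> 'a \<Rightarrow> 'a" +
  fixes P :: "('a \<Rightarrow> complex) set"
  assumes predual: "is_predual cs P"
begin

lemma predual_functional: "\<phi> \<in> P \<Longrightarrow> bdd_clinear_fun cs \<phi>"
  using predual unfolding is_predual_def by blast

lemma wstar_tendsto_diff: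
  assumes "wstar_tendsto P f x" "wstar_tendsto P g y"
  shows "wstar_tendsto P (\<lambda>k. f k - g k) (x - y)"
  using assms unfolding wstar_tendsto_def
  by (auto simp: functional_diff predual_functional intro!: tendsto_diff)

lemma wstar_tendsto_add:
  assumes "wstar_tendsto P f x" "wstar_tendsto P g y"
  shows "wstar_tendsto P (\<lambda>k. f k + g k) (x + y)"
  using assms unfolding wstar_tendsto_def
  by (auto simp: functional_add predual_functional intro!: tendsto_add)

lemma wstar_tendsto_scaleR:
  assumes "wstar_tendsto P f x"
  shows "wstar_tendsto P (\<lambda>k. r *\<^sub>R f k) (r *\<^sub>R x)"
  using assms unfolding wstar_tendsto_def
  by (auto simp: functional_scaleR predual_functional intro!: tendsto_mult_left)

lemma wstar_tendsto_iu:
  assumes "wstar_tendsto P f x"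
  shows "wstar_tendsto P (\<lambda>k. iu * f k) (iu * x)"
  using assms unfolding wstar_tendsto_def
  by (auto simp: functional_iu predual_functional intro!: tendsto_mult_left)

lemma wstar_tendsto_const: "wstar_tendsto P (\<lambda>k. x) x"
  unfolding wstar_tendsto_def by simp

text \<open>The norm is the supremum of \<open>cmod (\<phi> x)\<close> over the unit ball of the
  predual, and each of these bounds survives a pointwise limit.\<close>

lemma norm_wstar_limit_le:
  assumes lim: "wstar_tendsto P f x" and bound: "eventually (\<lambda>k. norm (f k) \<le> M) sequentially"
  shows "norm x \<le> M"
proof -
  have "norm x = Sup {cmod (\<phi> x) | \<phi>. \<phi> \<in> P \<and> dnorm \<phi> \<le> 1}"
    using predual unfolding is_predual_def by blast
  also have "\<dots> \<le> M"
  proof (rule cSup_least)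
    have "dnorm (\<lambda>x::'a. 0) = 0" 
    proof -
      have "{cmod 0 | x::'a. norm x \<le> 1} = {0}" by (auto intro: exI[of _ 0])
      then show ?thesis unfolding dnorm_def by simp
    qed
    moreover have "(\<lambda>x. 0) \<in> P" using predual unfolding is_predual_def by blast
    ultimately show "{cmod (\<phi> x) | \<phi>. \<phi> \<in> P \<and> dnorm \<phi> \<le> 1} \<noteq> {}" by force
  next
    fix c assume "c \<in> {cmod (\<phi> x) | \<phi>. \<phi> \<in> P \<and> dnorm \<phi> \<le> 1}"
    then obtain \<phi> where \<phi>: "c = cmod (\<phi> x)" "\<phi> \<in> P" "dnorm \<phi> \<le> 1" by blast
    have "(\<lambda>k. cmod (\<phi> (f k))) \<longlonglongrightarrow> c"
      using lim \<phi> unfolding wstar_tendsto_def by (auto intro: tendsto_norm)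
    moreover have "eventually (\<lambda>k. cmod (\<phi> (f k)) \<le> M) sequentially"
    proof (rule eventually_mono[OF bound])
      fix k assume M: "norm (f k) \<le> M"
      have "cmod (\<phi> (f k)) \<le> dnorm \<phi> * norm (f k)"
        using \<phi> by (intro cmod_functional_le predual_functional)
      also have "\<dots> \<le> 1 * norm (f k)" using \<phi> by (intro mult_right_mono) auto
      finally show "cmod (\<phi> (f k)) \<le> M" using M by simp
    qed
    ultimately show "c \<le> M" by (rule tendsto_upperbound) simp
  qed
  finally show ?thesis .
qed

lemma wstar_tendsto_unique:
  assumes "wstar_tendsto P f x" "wstar_tendsto P f y"
  shows "x = y"
  using norm_wstar_limit_le[OF wstar_tendsto_diff[OF assms], of 0] by simp

lemma wstar_lim_eq: "wstar_tendsto P f x \<Longrightarrow> wstar_lim P f = x"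
  unfolding wstar_lim_def by (blast intro: wstar_tendsto_unique)

text \<open>The pointwise limits form a bounded linear functional on the predual, which by duality
  is evaluation at an element.\<close>

lemma wstar_limit_exists:
  assumes conv: "\<And>\<phi>. \<phi> \<in> P \<Longrightarrow> convergent (\<lambda>k. \<phi> (f k))" and bound: "\<And>k. norm (f k) \<le> M"
  shows "\<exists>x. wstar_tendsto P f x"
proof -
  define F where "F \<phi> = lim (\<lambda>k. \<phi> (f k))" for \<phi> :: "'a \<Rightarrow> complex"
  have F: "(\<lambda>k. \<phi> (f k)) \<longlonglongrightarrow> F \<phi>" if "\<phi> \<in> P" for \<phi>
    unfolding F_def using conv[OF that] by (simp add: convergent_LIMSEQ_iff)
  have "F (\<lambda>x. \<phi> x + \<psi> x) = F \<phi> + F \<psi>" if "\<phi> \<in> P" "\<psi> \<in> P" for \<phi> \<psi>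
    unfolding F_def[of "\<lambda>x. \<phi> x + \<psi> x"] using tendsto_add[OF F[OF that(1)] F[OF that(2)]] by (rule limI)
  moreover have "F (\<lambda>x. a * \<phi> x) = a * F \<phi>" if "\<phi> \<in> P" for \<phi> a
    unfolding F_def[of "\<lambda>x. a * \<phi> x"] using tendsto_mult_left[OF F[OF that]] by (rule limI)
  moreover have "cmod (F \<phi>) \<le> M * dnorm \<phi>" if "\<phi> \<in> P" for \<phi>
  proof (rule LIMSEQ_le_const2[OF tendsto_norm[OF F[OF that]]], intro exI allI impI)
    fix k
    have "cmod (\<phi> (f k)) \<le> dnorm \<phi> * norm (f k)"
      using that by (intro cmod_functional_le predual_functional)
    also have "\<dots> \<le> dnorm \<phi> * M"
      using that bound by (intro mult_left_mono dnorm_nonneg predual_functional)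
    finally show "cmod (\<phi> (f k)) \<le> M * dnorm \<phi>" by (simp add: mult.commute)
  qed
  ultimately have "\<exists>x. \<forall>\<phi>\<in>P. F \<phi> = \<phi> x"
    using predual[unfolded is_predual_def, THEN conjunct2, THEN conjunct2, THEN conjunct2,
        THEN conjunct2, THEN conjunct2, THEN conjunct2, rule_format, of F]
    by blast
  then show ?thesis using F unfolding wstar_tendsto_def by metis
qed

section \<open>Limits of decreasing projections\<close>

text \<open>The wrong component \<open>y = x - x * e\<close> is eventually orthogonal to
  \<open>f k\<close>, so \<open>x + n y\<close> has squared norm at most
  \<open>M^2 + n^2 |y|^2\<close>, while its corner \<open>(x + n y) (1 - e)\<close> equals
  \<open>(n + 1) y\<close>.\<close>

lemma wstar_limit_mult_projection:
  assumes lim: "wstar_tendsto P f x" and bound: "\<And>k. norm (f k) \<le> M"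
    and e: "st e = e" "e * e = e" and fe: "eventually (\<lambda>k. f k * e = f k) sequentially"
  shows "x * e = x"
proof -
  define y where "y = x - x * e"
  have ye: "y * e = 0" using e by (simp add: y_def left_diff_distrib mult.assoc)
  have M: "M \<ge> 0" using bound[of 0] norm_ge_zero[of "f 0"] by linarith
  have "(2 * real n + 1) * (norm y)\<^sup>2 \<le> M\<^sup>2" for n
  proof -
    have "eventually (\<lambda>k. norm (f k + real n *\<^sub>R y) \<le> sqrt (M\<^sup>2 + (real n * norm y)\<^sup>2)) sequentially"
    proof (rule eventually_mono[OF fe])
      fix k assume fk: "f k * e = f k"
      have "f k * st y = f k * st (y * e)"
        by (metis e(1) fk mult.assoc st_mult)
      then have "f k * st (real n *\<^sub>R y) = 0" by (simp add: ye st_scaleR)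
      from norm_add_orthogonal[OF this]
      have "(norm (f k + real n *\<^sub>R y))\<^sup>2 \<le> (norm (f k))\<^sup>2 + (real n * norm y)\<^sup>2" by simp
      also have "\<dots> \<le> M\<^sup>2 + (real n * norm y)\<^sup>2" using bound[of k] by (simp add: power_mono)
      finally show "norm (f k + real n *\<^sub>R y) \<le> sqrt (M\<^sup>2 + (real n * norm y)\<^sup>2)"
        by (rule real_le_rsqrt)
    qed
    then have le: "norm (x + real n *\<^sub>R y) \<le> sqrt (M\<^sup>2 + (real n * norm y)\<^sup>2)"
      by (rule norm_wstar_limit_le[OF wstar_tendsto_add[OF lim wstar_tendsto_const]])
    have e': "st (1 - e) = 1 - e" "(1 - e) * (1 - e) = 1 - e"
      using e by (simp_all add: st_diff algebra_simps)
    have "(real n + 1) *\<^sub>R y = (x + real n *\<^sub>R y) * (1 - e)"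
    proof -
      have "(x + real n *\<^sub>R y) * (1 - e) = (x - x * e) + real n *\<^sub>R (y - y * e)"
        by (simp add: algebra_simps)
      then show ?thesis using ye by (simp add: algebra_simps flip: y_def)
    qed
    then have "(real n + 1) * norm y = norm ((x + real n *\<^sub>R y) * (1 - e))"
      by (metis norm_scaleR abs_of_nonneg add_nonneg_nonneg of_nat_0_le_iff zero_le_one)
    also have "\<dots> \<le> norm (x + real n *\<^sub>R y)"
      by (rule order_trans[OF norm_mult_ineq mult_left_le]) (use norm_projection_le_1[OF e'] in auto)
    finally have "((real n + 1) * norm y)\<^sup>2 \<le> (sqrt (M\<^sup>2 + (real n * norm y)\<^sup>2))\<^sup>2"
      using le by (intro power_mono) auto
    then show ?thesis by (simp add: power2_eq_square algebra_simps)
  qed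
  then have "(norm y)\<^sup>2 = 0"
    by (rule square_eq_0_of_linear_bound)
  then show ?thesis by (simp add: y_def)
qed

text \<open>Let \<open>R x\<close> be the limit of \<open>x * p k\<close>. Right multiplication by
  any \<open>p j\<close> fixes \<open>R x\<close>, and \<open>x - R x\<close> annihilates whatever
  all \<open>p j\<close> fix on the left. Together these force \<open>R x = x * q\<close> for the
  projection \<open>q = R 1\<close>.\<close>

lemma dec_projections_limit:
  assumes p: "dec_projections p"
  obtains q where "st q = q" "q * q = q" "\<And>j. p j * q = q"
    "\<And>y. \<forall>j. p j * y = y \<Longrightarrow> q * y = y" "\<And>x. wstar_tendsto P (\<lambda>k. x * p k) (x * q)"
proof -
  note pD = dec_projectionsD[OF p]
  have bound: "norm (x * p k) \<le> norm x" for x k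
    by (rule order_trans[OF norm_mult_ineq mult_left_le]) (use pD(3) in auto)
  have "\<exists>r. wstar_tendsto P (\<lambda>k. x * p k) r" for x
    using bound by (intro wstar_limit_exists dec_projections_convergent[OF p] predual_functional)
  then obtain R where R: "\<And>x. wstar_tendsto P (\<lambda>k. x * p k) (R x)" by metis
  have RK: "R x * p j = R x" for x j
  proof (rule wstar_limit_mult_projection[OF R bound pD(1,2)])
    show "eventually (\<lambda>k. x * p k * p j = x * p k) sequentially"
      using eventually_ge_at_top[of j] by eventually_elim (simp add: mult.assoc pD(5))
  qed
  \<comment> \<open>Before the limit, \<open>x - x * p k\<close> is orthogonal to \<open>w\<close>.
    The resulting bound passes to the limit and is the hypothesis of
    \<open>annihilates_hereditary\<close> with constant \<open>(norm x)^2\<close>.\<close>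
  have ineq: "(norm (x - R x + w))\<^sup>2 \<le> (norm x)\<^sup>2 + (norm w)\<^sup>2" if w: "\<forall>j. w * p j = w" for x w
  proof -
    have "norm (x - x * p k + w) \<le> sqrt ((norm x)\<^sup>2 + (norm w)\<^sup>2)" for k
    proof -
      have e: "st (1 - p k) = 1 - p k" "(1 - p k) * (1 - p k) = 1 - p k"
        using pD by (simp_all add: st_diff algebra_simps)
      have "p k * st w = st w" using w pD(1) by (metis st_mult)
      then have "(x - x * p k) * st w = 0" by (simp add: left_diff_distrib mult.assoc)
      then have "(norm (x - x * p k + w))\<^sup>2 \<le> (norm (x - x * p k))\<^sup>2 + (norm w)\<^sup>2"
        by (rule norm_add_orthogonal)
      moreover have "norm (x * (1 - p k)) \<le> norm x"
        by (rule order_trans[OF norm_mult_ineq mult_left_le]) (use norm_projection_le_1[OF e] in auto)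
      then have "(norm (x - x * p k))\<^sup>2 \<le> (norm x)\<^sup>2"
        by (simp add: right_diff_distrib power_mono)
      ultimately show ?thesis by (intro real_le_rsqrt) linarith
    qed
    then have "norm (x - R x + w) \<le> sqrt ((norm x)\<^sup>2 + (norm w)\<^sup>2)"
      by (intro norm_wstar_limit_le[OF wstar_tendsto_add[OF wstar_tendsto_diff[OF wstar_tendsto_const R]
            wstar_tendsto_const]] always_eventually allI)
    then show ?thesis
      using power_mono[of "norm (x - R x + w)" "sqrt ((norm x)\<^sup>2 + (norm w)\<^sup>2)" 2] by simp
  qed
  have Ry: "R x * y = x * y" if "\<And>j. p j * y = y" for x y
    using annihilates_hereditary[of p "x - R x" _ y, OF pD(1) ineq that] by (simp add: left_diff_distrib)
  define q where "q = R 1"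
  have stR: "p j * st (R x) = st (R x)" for j x using RK[of x j] pD(1) by (metis st_mult)
  \<comment> \<open>The case \<open>y = st q\<close> of \<open>Ry\<close>; as the left side is
    self-adjoint, so is \<open>q\<close>.\<close>
  have "q * st q = st q" using Ry[OF stR, of 1 1] by (simp add: q_def)
  then have q: "st q = q" by (metis st_mult st_st)
  show thesis
  proof
    show "st q = q" "q * q = q" using q \<open>q * st q = st q\<close> by simp_all
    show pq: "p j * q = q" for j using stR[of j 1] q by (simp add: q_def)
    show qy: "q * y = y" if "\<forall>j. p j * y = y" for y using Ry[of y 1] that by (simp add: q_def)
    have "R x = x * q" for x
    proof -
      have "q * st (R x) = st (R x)" using stR by (intro qy) simp
      then have "R x * q = R x" using q by (metis st_mult st_st)
      then show ?thesis using Ry[OF pq, of x] by simp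
    qed
    then show "wstar_tendsto P (\<lambda>k. x * p k) (x * q)" for x using R by metis
  qed
qed


text \<open>Conjugating by a unitary reduces multiplication on the right to multiplication on the left,
  and the Cayley transform recovers a self-adjoint \<open>y\<close> as a norm limit of combinations of unitaries.\<close>

lemma dec_projections_limit_two_sided:
  assumes p: "dec_projections p"
  obtains q where "st q = q" "q * q = q" "\<And>j. p j * q = q"
    "\<And>y. \<forall>j. p j * y = y \<Longrightarrow> q * y = y"
    "\<And>x y. wstar_tendsto P (\<lambda>k. x * p k * y) (x * q * y)"
proof -
  note pD = dec_projectionsD[OF p]
  obtain q where q: "st q = q" "q * q = q" "\<And>j. p j * q = q"
    "\<And>y. \<forall>j. p j * y = y \<Longrightarrow> q * y = y" "\<And>x. wstar_tendsto P (\<lambda>k. x * p k) (x * q)"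
    by (rule dec_projections_limit[OF p], rule that)
  have unitary: "wstar_tendsto P (\<lambda>k. x * p k * v) (x * q * v)"
    if v: "st v * v = 1" "v * st v = 1" for x v
  proof -
    obtain q' where q': "st q' = q'" "q' * q' = q'" "\<And>j. st v * p j * v * q' = q'"
      "\<And>y. \<forall>j. st v * p j * v * y = y \<Longrightarrow> q' * y = y"
      "\<And>x. wstar_tendsto P (\<lambda>k. x * (st v * p k * v)) (x * q')"
      by (rule dec_projections_limit[OF dec_projections_conjugate[OF p v]], rule that)
    \<comment> \<open>By the maximality of \<open>q\<close> and of \<open>q'\<close>, each of
      \<open>q'\<close> and \<open>st v * q * v\<close> absorbs the other, so they agree.\<close>
    have "p j * (v * q') = v * q'" for j
    proof -
      have "v * (st v * p j * v * q') = v * q'" using q'(3) by simp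
      then show ?thesis using v(2) by (simp flip: mult.assoc)
    qed
    then have "q * (v * q') = v * q'" by (intro q(4)) simp
    then have "st v * q * v * q' = q'" using v(1) by (metis mult.assoc mult_1_left)
    then have 1: "q' * (st v * q * v) = q'"
      using q'(1) q(1) by (metis mult.assoc st_mult st_st)
    have "st v * p j * v * (st v * q * v) = st v * q * v" for j
    proof -
      have "st v * p j * v * (st v * q * v) = st v * (p j * (v * st v) * q) * v"
        by (simp only: mult.assoc)
      then show ?thesis by (simp add: v(2) q(3))
    qed
    then have "q' * (st v * q * v) = st v * q * v" by (intro q'(4)) simp
    with 1 have q'_eq: "q' = st v * q * v" by simp
    have "x * v * (st v * a * v) = x * a * v" for a
    proof -
      have "x * v * (st v * a * v) = x * (v * st v) * a * v" by (simp only: mult.assoc)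
      then show ?thesis by (simp add: v(2))
    qed
    then show ?thesis using q'(5)[of "x * v"] unfolding q'_eq by simp
  qed
  have self_adjoint: "wstar_tendsto P (\<lambda>k. x * p k * y) (x * q * y)" if y: "st y = y" for x y
    unfolding wstar_tendsto_def
  proof
    fix \<phi> assume \<phi>P: "\<phi> \<in> P"
    note \<phi> = predual_functional[OF \<phi>P]
    show "(\<lambda>k. \<phi> (x * p k * y)) \<longlonglongrightarrow> \<phi> (x * q * y)"
    proof (rule LIMSEQ_I)
      fix \<epsilon> :: real assume \<epsilon>: "\<epsilon> > 0"
      define B where "B = dnorm \<phi> * norm x"
      have B: "B \<ge> 0" using dnorm_nonneg[OF \<phi>] by (simp add: B_def)
      have est: "cmod (\<phi> (x * a * w)) \<le> B * norm w" if "norm a \<le> 1" for a w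
      proof -
        have "norm (x * a * w) \<le> norm x * norm a * norm w"
          by (meson mult_right_mono norm_ge_zero norm_mult_ineq order_trans)
        also have "\<dots> \<le> norm x * norm w" using that by (simp add: mult_left_le mult_right_mono)
        finally have "dnorm \<phi> * norm (x * a * w) \<le> B * norm w"
          unfolding B_def mult.assoc using dnorm_nonneg[OF \<phi>] by (rule mult_left_mono)
        then show ?thesis using cmod_functional_le[OF \<phi>, of "x * a * w"] by linarith
      qed
      \<comment> \<open>Chosen so that \<open>B |y - w| < \<epsilon> / 4\<close> for
        \<open>w = y g\<close>, where \<open>y - w = i r y^2 g\<close>; the summand 1 keeps the
        denominator positive.\<close>
      define r where "r = \<epsilon> / (4 * (B * (norm (y * y)) + 1))"
      have den: "4 * (B * (norm (y * y)) + 1) > 0" using B by (simp add: add_nonneg_pos)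
      have r: "r > 0" using \<epsilon> den by (simp add: r_def)
      have ry: "st (r *\<^sub>R y) = r *\<^sub>R y" by (simp add: st_scaleR y)
      obtain g u where g: "(1 + iu * r *\<^sub>R y) * g = 1" and ng: "norm g \<le> 1"
        and u: "u = 2 *\<^sub>R g - 1" "st u * u = 1" "u * st u = 1"
        using cayley[OF ry] by blast
      have "(1/2) *\<^sub>R (a * u + a * 1) = a * g" for a
      proof -
        have "a * u + a * 1 = 2 *\<^sub>R (a * g)" by (simp add: u right_diff_distrib)
        then show ?thesis by simp
      qed
      then have lim_g: "wstar_tendsto P (\<lambda>k. x * p k * g) (x * q * g)"
        using wstar_tendsto_scaleR[OF wstar_tendsto_add[OF unitary[OF u(2,3), of x] unitary[of 1 x]], of "1/2"]
        by (simp only: st_1 mult_1_left simp_thms)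
      \<comment> \<open>This equals \<open>y * g\<close> but is written as an affine function of
        \<open>g\<close>, hence of the unitary \<open>u\<close>, so that the limit for
        \<open>w\<close> is already known.\<close>
      define w where "w = (1 / r) *\<^sub>R (iu * (g - 1))"
      have w_eq: "w = y * g"
      proof -
        have "g - 1 = - (r *\<^sub>R (iu * (y * g)))" using g by (simp add: algebra_simps)
        then show ?thesis unfolding w_def using r
          by (simp add: iu_iu_mult)
      qed
      have "wstar_tendsto P (\<lambda>k. (1 / r) *\<^sub>R (iu * (x * p k * g - x * p k))) ((1 / r) *\<^sub>R (iu * (x * q * g - x * q)))"
        by (intro wstar_tendsto_scaleR wstar_tendsto_iu wstar_tendsto_diff lim_g q(5))
      moreover have "(1 / r) *\<^sub>R (iu * (a * g - a)) = a * w" for a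
        by (simp add: w_def mult_iu_left right_diff_distrib mult_iu[of a])
      ultimately have "wstar_tendsto P (\<lambda>k. x * p k * w) (x * q * w)" by simp
      then have "(\<lambda>k. \<phi> (x * p k * w)) \<longlonglongrightarrow> \<phi> (x * q * w)"
        using \<phi>P unfolding wstar_tendsto_def by blast
      then obtain N where N: "\<And>k. k \<ge> N \<Longrightarrow> cmod (\<phi> (x * p k * w) - \<phi> (x * q * w)) < \<epsilon> / 2"
        using LIMSEQ_D[of _ _ "\<epsilon> / 2"] \<epsilon> by (metis half_gt_zero)
      have "y - w = r *\<^sub>R (iu * (y * y * g))"
      proof -
        have "y * ((1 + iu * r *\<^sub>R y) * g) = y" using g by simp
        then have "y = w + r *\<^sub>R (y * (iu * (y * g)))" by (simp add: w_eq algebra_simps)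
        then have "y = w + r *\<^sub>R (iu * (y * y * g))" by (simp add: mult_iu_left mult.assoc)
        then show ?thesis by (metis add_diff_cancel_left')
      qed
      then have "norm (y - w) = r * norm (y * y * g)" using r by simp
      also have "\<dots> \<le> r * norm (y * y)"
        using r ng by (intro mult_left_mono order_trans[OF norm_mult_ineq mult_left_le]) auto
      finally have "B * norm (y - w) \<le> B * (r * norm (y * y))" using B by (rule mult_left_mono)
      also have "\<dots> < r * (B * norm (y * y) + 1)" using r by (simp add: algebra_simps)
      also have "\<dots> = \<epsilon> / 4" unfolding r_def using den by (simp add: field_simps)
      finally have small: "B * norm (y - w) < \<epsilon> / 4" .
      have "cmod (\<phi> (x * p k * y) - \<phi> (x * q * y)) < \<epsilon>" if "k \<ge> N" for k
      proof -
        have "\<phi> (x * p k * y) - \<phi> (x * q * y) = (\<phi> (x * p k * w) - \<phi> (x * q * w))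
            + (\<phi> (x * p k * (y - w)) - \<phi> (x * q * (y - w)))"
          by (simp add: right_diff_distrib functional_diff[OF \<phi>])
        then have "cmod (\<phi> (x * p k * y) - \<phi> (x * q * y)) \<le> cmod (\<phi> (x * p k * w) - \<phi> (x * q * w))
            + (cmod (\<phi> (x * p k * (y - w))) + cmod (\<phi> (x * q * (y - w))))"
          by (metis add_left_mono norm_triangle_ineq norm_triangle_ineq4 order_trans)
        with N[OF that] est[of "p k" "y - w"] est[of q "y - w"] pD(3)[of k]
          norm_projection_le_1[OF q(1,2)] small
        show ?thesis by linarith
      qed
      then show "\<exists>no. \<forall>n\<ge>no. cmod (\<phi> (x * p n * y) - \<phi> (x * q * y)) < \<epsilon>" by blast
    qed
  qed
  have "wstar_tendsto P (\<lambda>k. x * p k * y) (x * q * y)" for x y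
  proof -
    obtain a b where ab: "st a = a" "st b = b" "y = a + iu * b" by (rule real_imaginary_parts)
    have "c * y = c * a + iu * (c * b)" for c by (simp add: ab(3) distrib_left mult_iu_left)
    then show ?thesis
      using wstar_tendsto_add[OF self_adjoint[OF ab(1)] wstar_tendsto_iu[OF self_adjoint[OF ab(2)]]]
      by simp
  qed
  with q(1-4) show thesis by (rule that)
qed

text \<open>Both outer factors vary with \<open>k\<close>. The left one is replaced by
  \<open>q\<close> through the Cauchy estimate that is uniform on the unit ball, into which the
  varying \<open>h * p k\<close> is scaled; the right one then converges by
  \<open>lim\<close>.\<close>

lemma dec_projections_compression_limit:
  assumes p: "dec_projections p"
    and lim: "\<And>x y. wstar_tendsto P (\<lambda>k. x * p k * y) (x * q * y)"
  shows "wstar_tendsto P (\<lambda>k. p k * h * p k) (q * h * q)"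
  unfolding wstar_tendsto_def
proof
  fix \<phi> assume \<phi>P: "\<phi> \<in> P"
  note \<phi> = predual_functional[OF \<phi>P] and pD = dec_projectionsD[OF p]
  have lim': "(\<lambda>k. \<phi> (p k * y)) \<longlonglongrightarrow> \<phi> (q * y)" for y
    using lim[of 1 y] \<phi>P unfolding wstar_tendsto_def by simp
  have "(\<lambda>k. \<phi> (p k * h * p k) - \<phi> (q * h * p k)) \<longlonglongrightarrow> 0"
  proof (rule LIMSEQ_I)
    fix \<epsilon> :: real assume \<epsilon>: "\<epsilon> > 0"
    define \<delta> where "\<delta> = \<epsilon> / (2 * (norm h + 1))"
    have hp: "norm h + 1 > 0" by (simp add: add_nonneg_pos)
    have \<delta>: "\<delta> > 0" using \<epsilon> hp by (simp add: \<delta>_def)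
    obtain N where N: "\<And>k j x. k \<ge> N \<Longrightarrow> j \<ge> N \<Longrightarrow> norm x \<le> 1 \<Longrightarrow> cmod (\<phi> (p k * x) - \<phi> (p j * x)) \<le> \<delta>"
      using dec_projections_uniformly_Cauchy[OF p \<phi> \<delta>] by blast
    have "cmod (\<phi> (p k * h * p k) - \<phi> (q * h * p k)) < \<epsilon>" if k: "k \<ge> N" for k
    proof -
      define x where "x = (1 / (norm h + 1)) *\<^sub>R (h * p k)"
      have "norm (h * p k) \<le> norm h"
        by (rule order_trans[OF norm_mult_ineq mult_left_le]) (use pD(3) in auto)
      then have nx: "norm x \<le> 1" using hp by (simp add: x_def divide_simps)
      \<comment> \<open>Only \<open>j\<close> tends to infinity here; \<open>x\<close> depends on
        \<open>k\<close>, but \<open>N\<close> does not depend on \<open>x\<close>.\<close>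
      have "(\<lambda>j. cmod (\<phi> (p k * x) - \<phi> (p j * x))) \<longlonglongrightarrow> cmod (\<phi> (p k * x) - \<phi> (q * x))"
        by (intro tendsto_intros lim')
      then have le: "cmod (\<phi> (p k * x) - \<phi> (q * x)) \<le> \<delta>"
        by (rule LIMSEQ_le_const2) (use N[OF k _ nx] in blast)
      have "h * p k = (norm h + 1) *\<^sub>R x" using hp by (simp add: x_def)
      then have "\<phi> (p k * h * p k) - \<phi> (q * h * p k)
          = complex_of_real (norm h + 1) * (\<phi> (p k * x) - \<phi> (q * x))"
        by (simp only: mult.assoc mult_scaleR_right functional_scaleR[OF \<phi>] right_diff_distrib)
      then have "cmod (\<phi> (p k * h * p k) - \<phi> (q * h * p k))
          = (norm h + 1) * cmod (\<phi> (p k * x) - \<phi> (q * x))"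
        using hp by (simp only: norm_mult norm_of_real abs_of_pos)
      also have "\<dots> \<le> (norm h + 1) * \<delta>" using le hp by (intro mult_left_mono) auto
      also have "\<dots> = \<epsilon> / 2" unfolding \<delta>_def using hp by (simp add: field_simps)
      finally show ?thesis using \<epsilon> by linarith
    qed
    then show "\<exists>no. \<forall>n\<ge>no. cmod (\<phi> (p n * h * p n) - \<phi> (q * h * p n) - 0) < \<epsilon>" by auto
  qed
  moreover have "(\<lambda>k. \<phi> (q * h * p k)) \<longlonglongrightarrow> \<phi> (q * h * q)"
    using lim[of "q * h" 1] \<phi>P unfolding wstar_tendsto_def by simp
  ultimately show "(\<lambda>k. \<phi> (p k * h * p k)) \<longlonglongrightarrow> \<phi> (q * h * q)"
    using tendsto_add by fastforce
qed

section \<open>The range projections of the powers of \<open>t'\<close>\<close>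

context
  fixes t assumes t: "ale st cs 1 (st t * t)"
begin

lemma ainvertible_st_mult_self: "ainvertible (st t * t)"
proof -
  have "-1 \<notin> aspectrum cs (st t * t - 1)"
    using t unfolding ale_def apos_def by (auto simp: complex_eq_iff)
  then show ?thesis
    using cs_of_real[of "-1" 1] unfolding aspectrum_def by simp
qed

lemma st_mult_tprime: "st t * tprime st t = 1"
  using ainvertible_inverse(1)[OF ainvertible_st_mult_self] by (simp add: tprime_def mult.assoc)

lemma st_tprime_mult_tprime: "st (tprime st t) * tprime st t = ainv (st t * t)"
proof -
  have "st (ainv (st t * t)) * (st t * t) = 1"
    using arg_cong[OF ainvertible_inverse(1)[OF ainvertible_st_mult_self], of st] by (simp add: st_mult)
  then have "st (tprime st t) * t = 1" by (simp add: tprime_def st_mult mult.assoc)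
  then show ?thesis by (simp add: tprime_def flip: mult.assoc)
qed

text \<open>Since \<open>st t\<close> is a left inverse of \<open>tprime st t\<close>, its powers
  are left inverses of the powers, and \<open>ainvertible_st_mult\<close> applies.\<close>

lemma cseq_inverse:
  "cseq st t k * ainv (cseq st t k) = 1" "ainv (cseq st t k) * cseq st t k = 1"
proof -
  have "st t ^ k * tprime st t ^ k = 1"
  proof (induction k)
    case (Suc k)
    have "st t ^ Suc k * tprime st t ^ Suc k = st t ^ k * (st t * tprime st t) * tprime st t ^ k"
      by (simp only: power_Suc2[of "st t"] power_Suc[of "tprime st t"] mult.assoc)
    with Suc show ?case by (simp add: st_mult_tprime)
  qed simp
  then have "ainvertible (cseq st t k)"
    unfolding cseq_def st_power[symmetric] by (rule ainvertible_st_mult)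
  then show "cseq st t k * ainv (cseq st t k) = 1" "ainv (cseq st t k) * cseq st t k = 1"
    by (rule ainvertible_inverse)+
qed

lemma st_ainv_cseq: "st (ainv (cseq st t k)) = ainv (cseq st t k)"
proof -
  have "st (cseq st t k) = cseq st t k" by (simp add: cseq_def st_mult st_power)
  then have "cseq st t k * st (ainv (cseq st t k)) = 1" "st (ainv (cseq st t k)) * cseq st t k = 1"
    using cseq_inverse[of k] by (metis st_1 st_mult)+
  then show ?thesis by (metis ainv_eq)
qed

section \<open>The projections \<open>p_k\<close>, the sequences \<open>u_k\<close> and
  \<open>v_k\<close>, and their limits\<close>

lemma pseq_mult_tprime_power:
  assumes "j \<le> k"
  shows "pseq st t j * tprime st t ^ k = tprime st t ^ k"
proof -
  have "pseq st t j * tprime st t ^ j = tprime st t ^ j * (ainv (cseq st t j) * cseq st t j)"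
    by (simp add: pseq_def cseq_def mult.assoc)
  then have "pseq st t j * tprime st t ^ j * tprime st t ^ (k - j) = tprime st t ^ j * tprime st t ^ (k - j)"
    by (simp add: cseq_inverse)
  then show ?thesis using assms by (simp add: mult.assoc flip: power_add)
qed

lemma dec_projections_pseq: "dec_projections (pseq st t)"
proof -
  have "st (pseq st t k) = pseq st t k" for k
    by (simp add: pseq_def st_mult st_power st_ainv_cseq mult.assoc)
  moreover have "pseq st t j * pseq st t k = pseq st t k" if "j \<le> k" for j k
    using pseq_mult_tprime_power[OF that] unfolding pseq_def[of st t k] by (simp flip: mult.assoc)
  ultimately show ?thesis unfolding dec_projections_def by blast
qed

lemma useq_eq: "useq st t k = tprime st t * pseq st t k * st (tprime st t)"
proof -
  have "useq st t k
      = (tprime st t * tprime st t ^ k) * ainv (cseq st t k) * (st (tprime st t) ^ k * st (tprime st t))"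
    by (simp add: useq_def power_commutes)
  then show ?thesis by (simp only: pseq_def mult.assoc)
qed

lemma vseq_eq: "vseq st t k = pseq st t k * ainv (st t * t) * pseq st t k"
proof -
  \<comment> \<open>With \<open>s = tprime st t\<close>, the innermost factor of
    \<open>c_(k+1)\<close> is \<open>st s * s\<close>, the inverse of
    \<open>st t * t\<close>.\<close>
  have "cseq st t (k + 1) = st (tprime st t) ^ k * ainv (st t * t) * tprime st t ^ k"
    unfolding cseq_def st_tprime_mult_tprime[symmetric]
    by (simp add: power_Suc2[of "st (tprime st t)"] mult.assoc del: power_Suc) (simp add: mult.assoc)
  then show ?thesis by (simp add: vseq_def pseq_def mult.assoc)
qed

lemma compression_eq_limit_difference:
  "wstar_lim P (pseq st t) *
     (ainv (st t * t) - tprime st t * wstar_lim P (pseq st t) * st (tprime st t)) *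
     wstar_lim P (pseq st t)
   = wstar_lim P (vseq st t) - wstar_lim P (useq st t)"
proof -
  define s where "s = tprime st t"
  note dp = dec_projections_pseq
  obtain q where q: "st q = q" "q * q = q" "\<And>j. pseq st t j * q = q"
    "\<And>y. \<forall>j. pseq st t j * y = y \<Longrightarrow> q * y = y"
    "\<And>x y. wstar_tendsto P (\<lambda>k. x * pseq st t k * y) (x * q * y)"
    by (rule dec_projections_limit_two_sided[OF dp], rule that)
  have p: "wstar_lim P (pseq st t) = q"
    using q(5)[of 1 1] by (intro wstar_lim_eq) simp
  have u: "wstar_lim P (useq st t) = s * q * st s"
    unfolding s_def using q(5) by (intro wstar_lim_eq) (simp add: useq_eq[abs_def])
  have v: "wstar_lim P (vseq st t) = q * ainv (st t * t) * q"
    using dec_projections_compression_limit[OF dp q(5)]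
    by (intro wstar_lim_eq) (simp add: vseq_eq[abs_def])
  \<comment> \<open>The product \<open>s p_j\<close> begins with \<open>s^(j+1)\<close>, which
    \<open>p_j\<close> fixes. As \<open>q = p_j q\<close>, every \<open>p_j\<close> fixes
    \<open>s q\<close>, and the maximality of \<open>q\<close> gives
    \<open>q s q = s q\<close>.\<close>
  have "pseq st t j * (s * q) = s * q" for j
  proof -
    have "pseq st t j * (s * pseq st t j) = s * pseq st t j"
    proof -
      have "s * pseq st t j = s ^ Suc j * (ainv (cseq st t j) * st s ^ j)"
        by (simp add: pseq_def s_def mult.assoc)
      moreover have "pseq st t j * s ^ Suc j = s ^ Suc j"
        unfolding s_def by (rule pseq_mult_tprime_power) simp
      ultimately show ?thesis by (metis mult.assoc)
    qed
    then show ?thesis using q(3)[of j] by (metis mult.assoc)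
  qed
  then have sq: "q * (s * q) = s * q" by (intro q(4)) simp
  have "st (q * (s * q)) = st (s * q)" by (simp only: sq)
  then have qs: "q * st s * q = q * st s" by (simp add: st_mult q(1) mult.assoc)
  have "q * (s * q * st s) * q = (q * (s * q)) * st s * q" by (simp only: mult.assoc)
  also have "\<dots> = s * (q * st s * q)" by (simp only: sq mult.assoc)
  also have "\<dots> = s * q * st s" by (simp only: qs) (simp only: mult.assoc)
  finally show ?thesis
    unfolding p u v s_def[symmetric] by (simp add: left_diff_distrib right_diff_distrib)
qed

end

end

theorem theorem8p8:
  fixes st :: "'a::{real_normed_algebra_1,banach} \<Rightarrow> 'a"
    and cs :: "complex \<Rightarrow> 'a \<Rightarrow> 'a"
    and P :: "('a \<Rightarrow> complex) set"
    and t :: 'a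
  assumes "wstar_algebra st cs P"
  shows "(spectral_radius cs t \<le> 1 \<and> ale st cs 1 (st t * t) \<and>
          apos st cs (wstar_lim P (pseq st t) *
                      (ainv (st t * t) - tprime st t * wstar_lim P (pseq st t) * st (tprime st t)) *
                      wstar_lim P (pseq st t)))
     \<longleftrightarrow>
         (spectral_radius cs t \<le> 1 \<and> ale st cs 1 (st t * t) \<and>
          ale st cs (wstar_lim P (useq st t)) (wstar_lim P (vseq st t)))"
proof -
  interpret wstar st cs P
    using assms unfolding wstar_algebra_def by unfold_locales auto
  \<comment> \<open>Under the common hypothesis on \<open>st t * t\<close>, both third clauses
    assert positivity of the same element; only the order relation between the two limits is
    unfolded.\<close>
  show ?thesis
    using compression_eq_limit_difference[of t] unfolding ale_def[of st cs "wstar_lim P (useq st t)"]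
    by metis
qed

end
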